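(* Let $n,k,r,s$ be non-negative integers with $k\ge1$ and $0\le r,s\le 2k-1$. Then $$\det\Big(C_{2n+2i+2j+r+s}^{(2k-1)}(r\to s)\Big)_{0\le i,j\le k-1}=\begin{cases}0,&\text{if }\gcd(r+1,2k+1)\ne1\text{ or }\gcd(s+1,2k+1)\ne1,\\ (-1)^{\sum_{i=1}^k\left(\lfloor\frac{i(r+1)}{2k+1}\rfloor+\lfloor\frac{i(s+1)}{2k+1}\rfloor\right)},&\text{if }\gcd(r+1,2k+1)=\gcd(s+1,2k+1)=1.\end{cases}$$
   Context: $C_N^{(K)}(r\to s)$ is the number of lattice paths with steps $(1,1),(1,-1)$ from $(0,r)$ to $(N,s)$ never going below the $x$-axis nor above the line $y=K$. *)

theory Defs
  imports "Jordan_Normal_Form.Determinant"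
begin

definition path_height :: "int \<Rightarrow> int list \<Rightarrow> nat \<Rightarrow> int" where
  "path_height r st m = r + sum_list (take m st)"

text \<open>Number of lattice paths with steps (1,1),(1,-1) from (0,r) to (N,s) never going
  below the x-axis nor above the line y = K.\<close>
definition C_paths :: "nat \<Rightarrow> nat \<Rightarrow> nat \<Rightarrow> nat \<Rightarrow> nat" where
  "C_paths K N r s = card {st :: int list. length st = N \<and> set st \<subseteq> {1, -1}
      \<and> (\<forall>m \<le> N. 0 \<le> path_height (int r) st m \<and> path_height (int r) st m \<le> int K)
      \<and> path_height (int r) st N = int s}"

end

theory Submission
  imports Defs
begin

text \<open>Diagonalise the adjacency matrix of the path \<open>0, \<dots>, 2 k - 1\<close>: with
  \<open>\<theta>\<^sub>l = l \<pi> / (2 k + 1)\<close> its eigenvalues are \<open>2 cos \<theta>\<^sub>l\<close>, with eigenvectors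
  \<open>sin ((a + 1) \<theta>\<^sub>l)\<close>. As \<open>N + r + s\<close> is even, the indices \<open>l\<close> and \<open>2 k + 1 - l\<close>
  contribute equally to the path count, so the Hankel matrix factors as \<open>V D V\<^sup>T\<close> with
  \<open>D\<close> diagonal and \<open>V\<close> a \<open>k\<times>k\<close> Vandermonde matrix in the squares of the eigenvalues.
  Expanding \<open>(2 cos \<theta>)\<^sup>2\<^sup>i sin \<theta>\<close> in the functions \<open>sin ((2 t + 1) \<theta>)\<close> is a
  unitriangular change of basis, and these functions are orthogonal at the points \<open>\<theta>\<^sub>l\<close>;
  this yields \<open>(det V)\<^sup>2\<close>. Since the \<open>2 cos \<theta>\<^sub>l\<close> have product \<open>1\<close>, the determinant
  is the product of \<open>sin ((r + 1) \<theta>\<^sub>l) sin ((s + 1) \<theta>\<^sub>l) / (sin \<theta>\<^sub>l)\<^sup>2\<close> over \<open>l\<close>,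
  which is evaluated as in Gauss's lemma.\<close>

section \<open>Recursion and basic counts for paths in a strip\<close>

text \<open>Heights and the bound \<open>K\<close> are integers, so the recursion on the first step
  may reach the forbidden heights \<open>-1\<close> and \<open>K + 1\<close>, where the set is
  simply empty.\<close>

definition paths :: "int \<Rightarrow> nat \<Rightarrow> int \<Rightarrow> int \<Rightarrow> int list set" where
  "paths K N a b = {st. length st = N \<and> set st \<subseteq> {1, -1}
      \<and> (\<forall>m \<le> N. 0 \<le> path_height a st m \<and> path_height a st m \<le> K)
      \<and> path_height a st N = b}"

lemma C_paths_eq_card_paths: "C_paths K N r s = card (paths (int K) N (int r) (int s))"
  by (simp add: C_paths_def paths_def)

lemma path_height_simps [simp]:
  "path_height a st 0 = a"
  "path_height a (x # st) (Suc m) = path_height (a + x) st m"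
  by (simp_all add: path_height_def)

lemma finite_paths: "finite (paths K N a b)"
  by (rule finite_subset[OF _ finite_lists_length_eq[of "{1, -1}" N]]) (auto simp: paths_def)

lemma paths_0: "paths K 0 a b = (if a = b \<and> 0 \<le> a \<and> a \<le> K then {[]} else {})"
  by (auto simp: paths_def)

lemma paths_outside: "\<not> (0 \<le> a \<and> a \<le> K) \<Longrightarrow> paths K N a b = {}"
  unfolding paths_def by (auto dest!: spec[of _ "0::nat"])

lemma paths_Suc:
  assumes "0 \<le> a" "a \<le> K"
  shows "paths K (Suc N) a b = (#) 1 ` paths K N (a + 1) b \<union> (#) (-1) ` paths K N (a - 1) b"
    (is "?L = ?R")
proof
  show "?R \<subseteq> ?L"
  proof
    fix st assume "st \<in> ?R"
    then obtain x xs where xs: "st = x # xs" "x \<in> {1, -1}" "xs \<in> paths K N (a + x) b" by force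
    have "0 \<le> path_height a st m \<and> path_height a st m \<le> K" if "m \<le> Suc N" for m
      using assms xs that by (cases m) (simp_all add: paths_def)
    with xs show "st \<in> ?L" by (auto simp: paths_def)
  qed
  show "?L \<subseteq> ?R"
  proof
    fix st assume st: "st \<in> ?L"
    then obtain x xs where xs: "st = x # xs" "length xs = N"
      by (auto simp: paths_def length_Suc_conv)
    have h: "0 \<le> path_height (a + x) xs m \<and> path_height (a + x) xs m \<le> K" if "m \<le> N" for m
      using st that unfolding paths_def xs by (auto dest: spec[of _ "Suc m"])
    have "xs \<in> paths K N (a + x) b" "x = 1 \<or> x = -1"
      using st h unfolding paths_def xs by auto
    then show "st \<in> ?R" unfolding xs by auto
  qed
qed

lemma card_paths_Suc:
  assumes "0 \<le> a" "a \<le> K"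
  shows "card (paths K (Suc N) a b) = card (paths K N (a + 1) b) + card (paths K N (a - 1) b)"
  unfolding paths_Suc[OF assms]
  by (subst card_Un_disjoint) (auto simp: finite_paths card_image)

text \<open>Each step changes the parity of the height. This discards endpoints of the wrong parity
  in the spectral expansions.\<close>

lemma paths_odd: "odd (int N + a + b) \<Longrightarrow> paths K N a b = {}"
proof (induction N arbitrary: a)
  case 0
  then show ?case by (auto simp: paths_0)
next
  case (Suc N)
  have "paths K N (a + 1) b = {}" "paths K N (a - 1) b = {}"
    by (rule Suc.IH, use Suc.prems in force)+
  then show ?case
    by (cases "0 \<le> a \<and> a \<le> K") (auto simp: paths_Suc paths_outside)
qed

text \<open>\<open>N\<close> steps raise the height by at most \<open>N\<close>. This gives the
  zeros above the diagonal of \<open>T\<close> in \<open>det_power_cos_mat\<close>.\<close>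

lemma paths_unreachable: "b > a + int N \<Longrightarrow> paths K N a b = {}"
proof (induction N arbitrary: a)
  case 0
  then show ?case by (auto simp: paths_0)
next
  case (Suc N)
  have "paths K N (a + 1) b = {}" "paths K N (a - 1) b = {}"
    by (rule Suc.IH, use Suc.prems in simp)+
  then show ?case
    by (cases "0 \<le> a \<and> a \<le> K") (auto simp: paths_Suc paths_outside)
qed

text \<open>Only up-steps can reach height \<open>a + int N\<close>. This gives the unit diagonal of
  the same matrix.\<close>

lemma card_paths_straight: "0 \<le> a \<Longrightarrow> a + int N \<le> K \<Longrightarrow> card (paths K N a (a + int N)) = 1"
proof (induction N arbitrary: a)
  case 0
  then show ?case by (auto simp: paths_0)
next
  case (Suc N)
  have "card (paths K N (a + 1) (a + int (Suc N))) = 1"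
    using Suc.IH[of "a + 1"] Suc.prems by (simp add: add.assoc)
  moreover have "paths K N (a - 1) (a + int (Suc N)) = {}"
    by (rule paths_unreachable) auto
  ultimately show ?case using Suc.prems by (simp add: card_paths_Suc)
qed

section \<open>Spectral action of the step operator\<close>

text \<open>The vector \<open>sin ((a + 1) \<theta>)\<close> is an eigenvector of the step operator, since it vanishes
  at the two forbidden heights \<open>-1\<close> and \<open>K + 1\<close>.\<close>

lemma cos_power_sin_eq_sum_paths:
  fixes \<theta> :: real
  assumes "sin ((real K + 2) * \<theta>) = 0" "-1 \<le> a" "a \<le> int K + 1"
  shows "(2 * cos \<theta>) ^ N * sin ((of_int a + 1) * \<theta>) =
    (\<Sum>s\<le>K. real (card (paths (int K) N a (int s))) * sin ((real s + 1) * \<theta>))"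
  using assms(2,3)
proof (induction N arbitrary: a)
  case (0 a)
  consider "a = -1" | "a = int K + 1" | "0 \<le> a" "a \<le> int K" using 0 by linarith
  then show ?case
  proof cases
    case 3
    then obtain t where t: "a = int t" "t \<le> K" by (metis nonneg_int_cases of_nat_le_iff)
    have "(\<Sum>s\<le>K. real (card (paths (int K) 0 a (int s))) * sin ((real s + 1) * \<theta>))
      = (\<Sum>s\<le>K. if s = t then sin ((real t + 1) * \<theta>) else 0)"
      by (rule sum.cong) (auto simp: paths_0 t)
    then show ?thesis using t by simp
  qed (use assms(1) in \<open>simp_all add: paths_outside algebra_simps\<close>)
next
  case (Suc N a)
  \<comment> \<open>The claim includes the two forbidden heights, where both sides vanish, so that
    in the remaining case the induction hypothesis applies at both \<open>a + 1\<close> and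
    \<open>a - 1\<close>.\<close>
  consider "a = -1" | "a = int K + 1" | "0 \<le> a" "a \<le> int K" using Suc.prems by linarith
  then show ?case
  proof cases
    case 3
    have "2 * cos \<theta> * sin ((of_int a + 1) * \<theta>) =
        sin ((of_int (a + 1) + 1) * \<theta>) + sin ((of_int (a - 1) + 1) * \<theta>)"
      using sin_add[of "(of_int a + 1) * \<theta>" \<theta>] sin_diff[of "(of_int a + 1) * \<theta>" \<theta>]
      by (simp add: algebra_simps)
    then have "(2 * cos \<theta>) ^ Suc N * sin ((of_int a + 1) * \<theta>) =
       (2 * cos \<theta>) ^ N * sin ((of_int (a + 1) + 1) * \<theta>)
       + (2 * cos \<theta>) ^ N * sin ((of_int (a - 1) + 1) * \<theta>)"
      by (simp add: distrib_left[symmetric] mult.assoc mult.left_commute)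
    also have "\<dots> = (\<Sum>s\<le>K. real (card (paths (int K) (Suc N) a (int s))) * sin ((real s + 1) * \<theta>))"
      using 3 Suc.IH[of "a + 1"] Suc.IH[of "a - 1"]
      by (simp only: card_paths_Suc of_nat_add distrib_right sum.distrib)
    finally show ?thesis .
  qed (use assms(1) in \<open>simp_all add: paths_outside algebra_simps\<close>)
qed

section \<open>Cosine sums and orthogonality of sines\<close>

text \<open>The sum telescopes: \<open>2 * sin x * cos (2 * l * x)\<close> is the difference of the
  sines of \<open>(2 * l + 1) * x\<close> and \<open>(2 * l - 1) * x\<close>.\<close>

lemma sum_cos_even_multiples:
  "2 * sin x * (\<Sum>l=1..k. cos (2 * real l * x)) = sin ((2 * real k + 1) * x) - sin x"
proof (induction k)
  case (Suc k)
  have "2 * sin x * cos (2 * real (Suc k) * x) = sin ((2 * real (Suc k) + 1) * x) - sin ((2 * real k + 1) * x)"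
    using sin_add[of "2 * real (Suc k) * x" x] sin_diff[of "2 * real (Suc k) * x" x]
    by (simp add: algebra_simps)
  with Suc show ?case by (simp add: distrib_left del: of_nat_Suc)
qed simp

lemma sin_pi_fraction_eq_0_iff:
  fixes a :: nat assumes "m > 0"
  shows "sin (real a * pi / real m) = 0 \<longleftrightarrow> m dvd a"
proof
  assume "sin (real a * pi / real m) = 0"
  then obtain i :: int where "real a * pi / real m = of_int i * pi" by (auto simp: sin_zero_iff_int2)
  then have "real a = of_int i * real m" using assms by (simp add: field_simps)
  then have "int a = i * int m" by (metis of_int_eq_iff of_int_mult of_int_of_nat_eq)
  then show "m dvd a" by (metis dvd_triv_right int_dvd_int_iff)
next
  assume "m dvd a"
  then obtain c where "a = m * c" ..
  then show "sin (real a * pi / real m) = 0" using assms by simp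
qed

text \<open>In the telescoped sum with \<open>x = d * pi / (2*k+1)\<close> the last sine is
  \<open>sin (d * pi) = 0\<close>, and the bounds on \<open>d\<close> allow division by
  \<open>sin x\<close>.\<close>

lemma sum_cos_even_pi_fraction:
  assumes "0 < d" "d < 2*k+1"
  shows "(\<Sum>l=1..k. cos (2 * real d * (real l * pi / real (2*k+1)))) = -1/2"
proof -
  define x where "x = real d * pi / real (2*k+1)"
  have "sin x \<noteq> 0"
    unfolding x_def by (subst sin_pi_fraction_eq_0_iff) (use assms in \<open>auto dest: dvd_imp_le\<close>)
  moreover have "(2 * real k + 1) * x = real d * pi" by (simp add: x_def field_simps)
  then have "sin x * (2 * (\<Sum>l=1..k. cos (2 * real l * x)) + 1) = 0"
    using sum_cos_even_multiples[of x k] by (simp add: algebra_simps)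
  ultimately have "(\<Sum>l=1..k. cos (2 * real l * x)) = -1/2"
    by simp
  moreover have "2 * real l * x = 2 * real d * (real l * pi / real (2*k+1))" for l
    by (simp add: x_def)
  ultimately show ?thesis by simp
qed

text \<open>Product-to-sum leaves two cosines; as \<open>s + t\<close> is even, both frequencies are
  even, so each cosine sum is \<open>-1/2\<close> and they cancel, except that frequency
  \<open>0\<close> gives \<open>k\<close> when \<open>s = t\<close>.\<close>

lemma sum_sin_sin_orthogonal:
  assumes "even (s + t)" "s < 2*k" "t < 2*k"
  defines "\<theta> \<equiv> \<lambda>l. real l * pi / real (2*k+1)"
  shows "(\<Sum>l=1..k. sin ((real s + 1) * \<theta> l) * sin ((real t + 1) * \<theta> l))
    = (if s = t then real (2*k+1) / 4 else 0)"
  using assms(1-3)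
proof (induction s t rule: linorder_wlog)
  case (le s t)
  have "even (t - s)" using le by simp
  then obtain d where d: "t = s + 2 * d" using le by (metis le_add_diff_inverse dvdE)
  have eq: "sin ((real s + 1) * \<theta> l) * sin ((real t + 1) * \<theta> l) =
      cos (2 * real d * \<theta> l) / 2 - cos (2 * real (s + d + 1) * \<theta> l) / 2" for l
  proof -
    have "sin ((real s + 1) * \<theta> l) * sin ((real t + 1) * \<theta> l)
       = (cos ((real s + 1) * \<theta> l - (real t + 1) * \<theta> l) - cos ((real s + 1) * \<theta> l + (real t + 1) * \<theta> l)) / 2"
      by (rule sin_times_sin)
    also have "(real s + 1) * \<theta> l - (real t + 1) * \<theta> l = - (2 * real d * \<theta> l)"
      by (simp add: d algebra_simps)
    also have "(real s + 1) * \<theta> l + (real t + 1) * \<theta> l = 2 * real (s + d + 1) * \<theta> l"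
      by (simp add: d algebra_simps)
    finally show ?thesis by (simp add: diff_divide_distrib)
  qed
  have 1: "(\<Sum>l=1..k. cos (2 * real (s + d + 1) * \<theta> l)) = -1/2"
    unfolding \<theta>_def by (rule sum_cos_even_pi_fraction) (use le d in auto)
  have 2: "(\<Sum>l=1..k. cos (2 * real d * \<theta> l)) = (if d = 0 then real k else -1/2)"
    unfolding \<theta>_def using sum_cos_even_pi_fraction[of d k] le d by auto
  show ?case
    unfolding eq sum_subtractf sum_divide_distrib[symmetric] 1 2 using d by (auto simp: field_simps)
next
  case (sym s t)
  then show ?case by (simp add: mult.commute add.commute)
qed

section \<open>Sine products at multiples of pi / (2k+1)\<close>

text \<open>Every shift by pi flips the sign of the sine; this is the source of the floors in the
  final exponent.\<close>

lemma sin_mod_pi_fraction: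
  fixes a m :: nat assumes "m > 0"
  shows "sin (real a * pi / real m) = (-1) ^ (a div m) * sin (real (a mod m) * pi / real m)"
proof -
  have "real a = real (a div m) * real m + real (a mod m)"
    by (metis div_mult_mod_eq of_nat_add of_nat_mult)
  then have "real a * pi / real m = real (a mod m) * pi / real m + real (a div m) * pi"
    using assms by (simp add: field_simps)
  then show ?thesis by (simp add: sin_add)
qed

text \<open>As in Gauss's lemma, multiplication by \<open>a\<close> permutes \<open>{1..k}\<close> up to sign modulo \<open>2 k + 1\<close>.\<close>

lemma prod_sin_coprime:
  assumes "coprime a (2*k+1)"
  shows "(\<Prod>l=1..k. sin (real (l*a) * pi / real (2*k+1)))
    = (-1) ^ (\<Sum>l=1..k. (l*a) div (2*k+1)) * (\<Prod>l=1..k. sin (real l * pi / real (2*k+1)))"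
proof -
  define m where "m = 2*k+1"
  \<comment> \<open>\<open>f l\<close> is the distance from \<open>l * a\<close> to the nearest
    multiple of \<open>m\<close>; replacing a residue \<open>u\<close> by \<open>m - u\<close> does
    not change \<open>sin (u * pi / m)\<close>.\<close>
  define f where "f l = min ((l*a) mod m) (m - (l*a) mod m)" for l
  have ndvd: "\<not> m dvd l * a" if "l \<in> {1..k}" for l
  proof
    assume "m dvd l * a"
    then have "m dvd l" using assms by (simp add: m_def coprime_commute coprime_dvd_mult_left_iff)
    then show False using that by (auto simp: m_def dest: dvd_imp_le)
  qed
  have "f ` {1..k} \<subseteq> {1..k}"
  proof (rule image_subsetI)
    fix l assume "l \<in> {1..k}"
    then have "(l * a) mod m \<noteq> 0" "(l * a) mod m < m"
      using ndvd by (auto simp: dvd_eq_mod_eq_0 m_def)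
    then show "f l \<in> {1..k}"
      unfolding f_def atLeastAtMost_iff m_def by linarith
  qed
  moreover have "inj_on f {1..k}"
  proof (rule inj_onI)
    fix x y assume xy: "x \<in> {1..k}" "y \<in> {1..k}" "f x = f y"
    define u v where "u = (x * a) mod m" and "v = (y * a) mod m"
    have uv: "u < m" "v < m" by (auto simp: u_def v_def m_def)
    \<comment> \<open>Equal distances mean that the residues agree or are opposite modulo
      \<open>m\<close>.\<close>
    then have "u = v \<or> u + v = m" using xy(3) by (auto simp: f_def u_def[symmetric] v_def[symmetric] min_def split: if_splits)
    then show "x = y"
    proof
      assume "u = v"
      then have "int m dvd int x * int a - int y * int a"
        unfolding u_def v_def by (metis mod_eq_dvd_iff of_nat_mod of_nat_mult)
      then have "int m dvd (int x - int y) * int a" by (simp add: algebra_simps)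
      then have "int m dvd int x - int y" using assms
        by (metis coprime_commute coprime_dvd_mult_left_iff coprime_int_iff m_def)
      moreover have "\<bar>int x - int y\<bar> < int m" using xy by (auto simp: m_def)
      ultimately have "int x - int y = 0"
        using dvd_imp_le_int[of "int x - int y" "int m"] by fastforce
      then show ?thesis by simp
    next
      assume "u + v = m"
      then have "m dvd x * a + y * a"
        unfolding u_def v_def by (metis dvd_eq_mod_eq_0 mod_add_eq mod_self)
      then have "m dvd (x + y) * a" by (simp add: algebra_simps)
      \<comment> \<open>Opposite residues are impossible, because
        \<open>0 < x + y \<le> 2 * k < m\<close>.\<close>
      then have "m dvd x + y" using assms by (simp add: m_def coprime_commute coprime_dvd_mult_left_iff)
      then show ?thesis using xy by (auto simp: m_def dest: dvd_imp_le)
    qed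
  qed
  ultimately have bij: "bij_betw f {1..k} {1..k}"
    by (simp add: bij_betw_def endo_inj_surj)
  have sin_f: "sin (real (f l) * pi / real m) = sin (real ((l*a) mod m) * pi / real m)" for l
  proof -
    have "(l*a) mod m < m" by (simp add: m_def)
    then have "real (m - (l*a) mod m) * pi / real m = pi - real ((l*a) mod m) * pi / real m"
      by (simp add: of_nat_diff field_simps)
    then show ?thesis by (simp add: f_def min_def)
  qed
  have "(\<Prod>l=1..k. sin (real (l*a) * pi / real m))
      = (\<Prod>l=1..k. (-1) ^ ((l*a) div m) * sin (real (f l) * pi / real m))"
    unfolding sin_f by (rule prod.cong[OF refl], rule sin_mod_pi_fraction) (simp add: m_def)
  also have "\<dots> = (-1) ^ (\<Sum>l=1..k. (l*a) div m) * (\<Prod>l=1..k. sin (real (f l) * pi / real m))"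
    by (simp add: prod.distrib power_sum)
  also have "(\<Prod>l=1..k. sin (real (f l) * pi / real m)) = (\<Prod>l=1..k. sin (real l * pi / real m))"
    by (rule prod.reindex_bij_betw[OF bij])
  finally show ?thesis unfolding m_def .
qed

text \<open>With \<open>g = gcd a (2*k+1)\<close>, the index \<open>l = (2*k+1) div g\<close> makes
  \<open>l * a\<close> a multiple of \<open>2*k+1\<close>, so its factor vanishes;
  \<open>g \<ge> 2\<close> puts this \<open>l\<close> into \<open>{1..k}\<close>.\<close>

lemma prod_sin_not_coprime:
  assumes "gcd a (2*k+1) \<noteq> 1"
  shows "(\<Prod>l=1..k. sin (real (l*a) * pi / real (2*k+1))) = 0"
proof -
  define g where "g = gcd a (2*k+1)"
  obtain l where l: "2*k+1 = g * l" by (metis dvdE gcd_dvd2 g_def)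
  obtain b where b: "a = g * b" by (metis dvdE gcd_dvd1 g_def)
  have "odd g" using l by (metis even_mult_iff even_plus_one_iff dvd_triv_left)
  then have "g \<ge> 2" using assms unfolding g_def by (cases "gcd a (2*k+1)" rule: nat.exhaust) (auto simp: g_def)
  then have "2 * l \<le> 2*k+1" unfolding l by simp
  moreover have "l > 0" using l by (cases l) auto
  ultimately have "l \<in> {1..k}" by auto
  moreover have "2*k+1 dvd l * a" unfolding l b by simp
  then have "sin (real (l*a) * pi / real (2*k+1)) = 0"
    by (subst sin_pi_fraction_eq_0_iff) auto
  ultimately show ?thesis by (auto intro!: prod_zero)
qed

lemma prod_sin_pi_fraction_nonzero: "(\<Prod>l=1..k. sin (real l * pi / real (2*k+1))) \<noteq> 0"
  by (simp del: of_nat_Suc of_nat_add of_nat_mult add: sin_pi_fraction_eq_0_iff) (auto dest: dvd_imp_le)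

text \<open>By the double angle formula this is the quotient of the sine products for multipliers
  \<open>2\<close> and \<open>1\<close>. The sign is trivial since
  \<open>2 * l < 2*k+1\<close>.\<close>

lemma prod_2_cos: "(\<Prod>l=1..k. 2 * cos (real l * pi / real (2*k+1))) = 1"
proof -
  let ?S = "\<Prod>l=1..k. sin (real l * pi / real (2*k+1))"
  have "(\<Prod>l=1..k. sin (real (l*2) * pi / real (2*k+1)))
      = (\<Prod>l=1..k. (2 * cos (real l * pi / real (2*k+1))) * sin (real l * pi / real (2*k+1)))"
  proof (rule prod.cong)
    fix l
    have "real (l*2) * pi / real (2*k+1) = 2 * (real l * pi / real (2*k+1))" by simp
    then show "sin (real (l*2) * pi / real (2*k+1))
        = (2 * cos (real l * pi / real (2*k+1))) * sin (real l * pi / real (2*k+1))"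
      by (simp only: sin_double mult_ac)
  qed simp
  also have "\<dots> = (\<Prod>l=1..k. 2 * cos (real l * pi / real (2*k+1))) * ?S"
    by (rule prod.distrib)
  finally have "(\<Prod>l=1..k. 2 * cos (real l * pi / real (2*k+1))) * ?S
      = (-1) ^ (\<Sum>l=1..k. (l*2) div (2*k+1)) * ?S"
    using prod_sin_coprime[of 2 k] by simp
  also have "(\<Sum>l=1..k. (l*2) div (2*k+1)) = 0" by (intro sum.neutral) auto
  finally show ?thesis using prod_sin_pi_fraction_nonzero[of k] by simp
qed

section \<open>Spectral formulas for the path counts\<close>

text \<open>Multiply the eigenvector expansion by \<open>sin ((s + 1) * \<theta> l)\<close> and sum
  over \<open>l\<close>. On the half range \<open>{1..k}\<close> orthogonality is available for
  indices of equal parity; endpoints \<open>u\<close> of the other parity carry no paths, as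
  \<open>N + r + s\<close> is even.\<close>

lemma C_paths_spectral:
  assumes "r < 2*k" "s < 2*k" "even (N + r + s)"
  defines "\<theta> \<equiv> \<lambda>l. real l * pi / real (2*k+1)"
  shows "real (C_paths (2*k-1) N r s) = 4 / real (2*k+1) *
    (\<Sum>l=1..k. (2 * cos (\<theta> l)) ^ N * sin ((real r + 1) * \<theta> l) * sin ((real s + 1) * \<theta> l))"
proof -
  let ?C = "\<lambda>u. real (C_paths (2*k-1) N r u)"
  have expand: "(2 * cos (\<theta> l)) ^ N * sin ((real r + 1) * \<theta> l) = (\<Sum>u<2*k. ?C u * sin ((real u + 1) * \<theta> l))" for l
  proof -
    \<comment> \<open>The upper forbidden height is \<open>2*k\<close>, where the sine has argument
      \<open>(2*k+1) * \<theta> l\<close>, a multiple of pi.\<close>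
    have "(real (2*k-1) + 2) * \<theta> l = real l * pi" using assms by (simp add: \<theta>_def of_nat_diff field_simps)
    moreover have "{..2*k-1} = {..<2*k}" using assms by auto
    ultimately show ?thesis
      using cos_power_sin_eq_sum_paths[of "2*k-1" "\<theta> l" "int r" N] assms
      by (simp add: C_paths_eq_card_paths)
  qed
  have "(\<Sum>l=1..k. (2 * cos (\<theta> l)) ^ N * sin ((real r + 1) * \<theta> l) * sin ((real s + 1) * \<theta> l))
      = (\<Sum>l=1..k. \<Sum>u<2*k. ?C u * (sin ((real u + 1) * \<theta> l) * sin ((real s + 1) * \<theta> l)))"
    unfolding expand by (simp add: sum_distrib_right mult.assoc)
  also have "\<dots> = (\<Sum>u<2*k. ?C u * (\<Sum>l=1..k. sin ((real u + 1) * \<theta> l) * sin ((real s + 1) * \<theta> l)))"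
    by (subst sum.swap) (simp add: sum_distrib_left)
  also have "\<dots> = (\<Sum>u<2*k. if u = s then ?C s * (real (2*k+1) / 4) else 0)"
  proof (rule sum.cong)
    fix u assume u: "u \<in> {..<2*k}"
    show "?C u * (\<Sum>l=1..k. sin ((real u + 1) * \<theta> l) * sin ((real s + 1) * \<theta> l))
       = (if u = s then ?C s * (real (2*k+1) / 4) else 0)"
    proof (cases "even (u + s)")
      case True
      then show ?thesis using sum_sin_sin_orthogonal[of u s k] u assms by simp
    next
      case False
      then have "odd (int N + int r + int u)" using assms(3) by auto
      then have "?C u = 0" by (simp add: C_paths_eq_card_paths paths_odd)
      moreover have "u \<noteq> s" using False by auto
      ultimately show ?thesis by simp
    qed
  qed simp
  also have "\<dots> = ?C s * (real (2*k+1) / 4)" using assms by simp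
  finally show ?thesis by (simp add: field_simps)
qed

text \<open>Paths of even length from height \<open>0\<close> end at even heights, so only the
  odd-frequency sines survive.\<close>

lemma even_power_sin_expansion:
  assumes "k \<ge> 1"
  defines "\<theta> \<equiv> \<lambda>l. real l * pi / real (2*k+1)"
  shows "(2 * cos (\<theta> l)) ^ (2*i) * sin (\<theta> l) =
    (\<Sum>t<k. real (C_paths (2*k-1) (2*i) 0 (2*t)) * sin ((real (2*t) + 1) * \<theta> l))"
proof -
  let ?f = "\<lambda>u. real (C_paths (2*k-1) (2*i) 0 u) * sin ((real u + 1) * \<theta> l)"
  have "(real (2*k-1) + 2) * \<theta> l = real l * pi" using assms by (simp add: \<theta>_def of_nat_diff field_simps)
  then have "(2 * cos (\<theta> l)) ^ (2*i) * sin (\<theta> l) = (\<Sum>u\<le>2*k-1. ?f u)"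
    using cos_power_sin_eq_sum_paths[of "2*k-1" "\<theta> l" 0 "2*i"]
    by (simp add: C_paths_eq_card_paths)
  also have "\<dots> = sum ?f ((*) 2 ` {..<k})"
  proof (rule sum.mono_neutral_right)
    show "\<forall>u\<in>{..2*k-1} - (*) 2 ` {..<k}. ?f u = 0"
    proof
      fix u assume u: "u \<in> {..2*k-1} - (*) 2 ` {..<k}"
      have "odd u"
      proof
        assume "even u"
        then obtain t where "u = 2 * t" ..
        with u assms(1) show False by auto
      qed
      then have "odd (int (2*i) + int 0 + int u)" by simp
      then show "?f u = 0" unfolding C_paths_eq_card_paths by (simp add: paths_odd)
    qed
  qed (use assms in auto)
  also have "\<dots> = (\<Sum>t<k. ?f (2*t))"
    by (subst sum.reindex) (auto simp: inj_on_def)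
  finally show ?thesis .
qed

section \<open>Matrix factorisations and their determinants\<close>

lemma sum_lessThan_shift_1: "(\<Sum>l<k. f (Suc l)) = (\<Sum>l=1..k. f l)"
  by (simp add: sum.atLeast1_atMost_eq)

lemma prod_lessThan_shift_1: "(\<Prod>l<k. f (Suc l)) = (\<Prod>l=1..k. f l)"
  by (simp add: prod.atLeast1_atMost_eq)

lemma det_diagonal_mat: "det (mat k k (\<lambda>(i,j). if i = j then d i else 0)) = (\<Prod>i<k. d i)"
proof -
  have "det (mat k k (\<lambda>(i,j). if i = j then d i else 0)) = prod_list (diag_mat (mat k k (\<lambda>(i,j). if i = j then d i else 0)))"
    by (rule det_upper_triangular) auto
  also have "\<dots> = (\<Prod>i<k. d i)" 
    by (auto simp: prod_list_diag_prod atLeast0LessThan intro!: prod.cong)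
  finally show ?thesis .
qed

lemma mult_diagonal_mat:
  assumes "A \<in> carrier_mat n k"
  shows "A * mat k k (\<lambda>(i,j). if i = j then d i else 0) = mat n k (\<lambda>(i,j). A $$ (i,j) * d j)"
  using assms by (intro eq_matI) (auto simp: scalar_prod_def if_distrib cong: if_cong)

text \<open>Take determinants in \<open>T * S = V * D\<close>, where \<open>T\<close> is
  unitriangular and \<open>S * S\<^sup>T\<close> is scalar by orthogonality; no Vandermonde product
  has to be evaluated.\<close>

lemma det_power_cos_mat:
  assumes "k \<ge> 1"
  defines "\<theta> \<equiv> \<lambda>l. real l * pi / real (2*k+1)"
  defines "V \<equiv> mat k k (\<lambda>(i,l). (2 * cos (\<theta> (Suc l))) ^ (2*i))"
  shows "(det V)\<^sup>2 * (\<Prod>l=1..k. sin (\<theta> l))\<^sup>2 = (real (2*k+1) / 4) ^ k"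
proof -
  define T where "T = mat k k (\<lambda>(i,t). real (C_paths (2*k-1) (2*i) 0 (2*t)))"
  define S where "S = mat k k (\<lambda>(t,l). sin ((real (2*t) + 1) * \<theta> (Suc l)))"
  define D where "D = mat k k (\<lambda>(i,j). if i = j then sin (\<theta> (Suc i)) else 0)"
  have carr [simp]: "T \<in> carrier_mat k k" "S \<in> carrier_mat k k" "D \<in> carrier_mat k k" "V \<in> carrier_mat k k"
    by (simp_all add: T_def S_def D_def V_def)
  have "det T = prod_list (diag_mat T)"
  proof (rule det_lower_triangular[of k])
    fix i j assume "i < j" "j < k"
    then show "T $$ (i,j) = 0"
      by (simp add: T_def C_paths_eq_card_paths paths_unreachable)
  qed simp
  also have "\<dots> = 1"
  proof -
    have "T $$ (i,i) = 1" if "i < k" for i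
      using that card_paths_straight[of 0 "2*i" "int (2*k-1)"]
      by (simp add: T_def C_paths_eq_card_paths)
    then show ?thesis by (simp add: prod_list_diag_prod T_def)
  qed
  finally have detT: "det T = 1" .
  have "T * S = V * D"
    unfolding D_def mult_diagonal_mat[OF carr(4)]
  proof (rule eq_matI)
    fix i j assume "i < dim_row (mat k k (\<lambda>(i,j). V $$ (i,j) * sin (\<theta> (Suc j))))"
      "j < dim_col (mat k k (\<lambda>(i,j). V $$ (i,j) * sin (\<theta> (Suc j))))"
    then have ij: "i < k" "j < k" by simp_all
    then have "(T * S) $$ (i,j) = (\<Sum>t<k. real (C_paths (2*k-1) (2*i) 0 (2*t)) * sin ((real (2*t) + 1) * \<theta> (Suc j)))"
      by (simp add: T_def S_def scalar_prod_def atLeast0LessThan)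
    also have "\<dots> = (2 * cos (\<theta> (Suc j))) ^ (2*i) * sin (\<theta> (Suc j))"
      unfolding \<theta>_def by (rule even_power_sin_expansion[OF assms(1), symmetric])
    finally show "(T * S) $$ (i,j) = mat k k (\<lambda>(i,j). V $$ (i,j) * sin (\<theta> (Suc j))) $$ (i,j)"
      using ij by (simp add: V_def)
  qed (simp_all add: T_def S_def V_def)
  then have "det S = det V * (\<Prod>l=1..k. sin (\<theta> l))"
    using det_mult[OF carr(1,2)] det_mult[OF carr(4,3)] detT
    by (simp add: D_def det_diagonal_mat prod_lessThan_shift_1[of "\<lambda>l. sin (\<theta> l)"])
  moreover have "S * S\<^sup>T = (real (2*k+1) / 4) \<cdot>\<^sub>m 1\<^sub>m k"
  proof (rule eq_matI)
    fix i j assume "i < dim_row ((real (2*k+1) / 4) \<cdot>\<^sub>m 1\<^sub>m k)" "j < dim_col ((real (2*k+1) / 4) \<cdot>\<^sub>m (1\<^sub>m k :: real mat))"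
    then have ij: "i < k" "j < k" by simp_all
    then have "(S * S\<^sup>T) $$ (i,j) = (\<Sum>l<k. sin ((real (2*i) + 1) * \<theta> (Suc l)) * sin ((real (2*j) + 1) * \<theta> (Suc l)))"
      by (simp add: S_def scalar_prod_def atLeast0LessThan)
    also have "\<dots> = (if 2*i = 2*j then real (2*k+1) / 4 else 0)"
      unfolding sum_lessThan_shift_1[of "\<lambda>l. sin ((real (2*i) + 1) * \<theta> l) * sin ((real (2*j) + 1) * \<theta> l)"]
      unfolding \<theta>_def by (rule sum_sin_sin_orthogonal) (use ij in auto)
    finally show "(S * S\<^sup>T) $$ (i,j) = ((real (2*k+1) / 4) \<cdot>\<^sub>m 1\<^sub>m k) $$ (i,j)"
      using ij by auto
  qed (simp_all add: S_def)
  then have "(det S)\<^sup>2 = (real (2*k+1) / 4) ^ k"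
    using det_mult[of S k "S\<^sup>T"] det_transpose[OF carr(2)]
    by (simp add: power2_eq_square)
  ultimately show ?thesis by (simp add: power_mult_distrib)
qed

text \<open>In the determinant of \<open>V * D * V\<^sup>T\<close> the powers with exponent
  \<open>2*n+r+s\<close> multiply to \<open>1\<close> by \<open>prod_2_cos\<close>, and the
  constants \<open>4 / (2*k+1)\<close> cancel against \<open>(det V)\<^sup>2\<close>.\<close>

lemma det_real_C_paths:
  assumes "k \<ge> 1" "r < 2*k" "s < 2*k"
  defines "\<theta> \<equiv> \<lambda>l. real l * pi / real (2*k+1)"
  shows "det (mat k k (\<lambda>(i,j). real (C_paths (2*k-1) (2*n + 2*i + 2*j + r + s) r s)))
      * (\<Prod>l=1..k. sin (\<theta> l))\<^sup>2
    = (\<Prod>l=1..k. sin ((real r + 1) * \<theta> l)) * (\<Prod>l=1..k. sin ((real s + 1) * \<theta> l))"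
    (is "det ?H * _ = _")
proof -
  define V where "V = mat k k (\<lambda>(i,l). (2 * cos (\<theta> (Suc l))) ^ (2*i))"
  \<comment> \<open>The part of the spectral summand independent of \<open>i\<close> and
    \<open>j\<close>; the powers \<open>2*i\<close> and \<open>2*j\<close> go into the two outer
    factors.\<close>
  define d where "d l = 4 / real (2*k+1) * ((2 * cos (\<theta> l)) ^ (2*n+r+s)
     * (sin ((real r + 1) * \<theta> l) * sin ((real s + 1) * \<theta> l)))" for l
  define D where "D = mat k k (\<lambda>(i,j). if i = j then d (Suc i) else 0)"
  have carr [simp]: "V \<in> carrier_mat k k" "D \<in> carrier_mat k k"
    by (simp_all add: D_def V_def)
  have VD [simp]: "V * D \<in> carrier_mat k k" by (rule mult_carrier_mat[OF carr])
  have "?H = V * D * V\<^sup>T"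
  proof (rule eq_matI)
    fix i j assume "i < dim_row (V * D * V\<^sup>T)" "j < dim_col (V * D * V\<^sup>T)"
    then have ij: "i < k" "j < k" by (simp_all add: V_def)
    have "(V * D * V\<^sup>T) $$ (i,j) = (\<Sum>l<k. (2 * cos (\<theta> (Suc l))) ^ (2*i) * d (Suc l) * (2 * cos (\<theta> (Suc l))) ^ (2*j))"
      using ij unfolding D_def mult_diagonal_mat[OF carr(1)]
      by (simp add: V_def scalar_prod_def atLeast0LessThan)
    also have "\<dots> = (\<Sum>l=1..k. (2 * cos (\<theta> l)) ^ (2*i) * d l * (2 * cos (\<theta> l)) ^ (2*j))"
      by (rule sum_lessThan_shift_1)
    also have "\<dots> = 4 / real (2*k+1) * (\<Sum>l=1..k. (2 * cos (\<theta> l)) ^ (2*n + 2*i + 2*j + r + s)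
        * sin ((real r + 1) * \<theta> l) * sin ((real s + 1) * \<theta> l))"
      unfolding sum_distrib_left by (rule sum.cong) (simp_all add: d_def power_add mult_ac)
    also have "\<dots> = real (C_paths (2*k-1) (2*n + 2*i + 2*j + r + s) r s)"
      unfolding \<theta>_def by (rule C_paths_spectral[symmetric]) (use assms in auto)
    finally show "?H $$ (i,j) = (V * D * V\<^sup>T) $$ (i,j)" using ij by simp
  qed (simp_all add: V_def)
  then have H: "det ?H = (det V)\<^sup>2 * (\<Prod>l=1..k. d l)"
    using det_mult[OF VD, of "V\<^sup>T"] det_mult[OF carr] det_transpose[OF carr(1)]
      det_diagonal_mat[of k "\<lambda>i. d (Suc i)", folded D_def]
    by (simp add: prod_lessThan_shift_1 power2_eq_square mult_ac)
  have d: "(\<Prod>l=1..k. d l) = (4 / real (2*k+1)) ^ k *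
      ((\<Prod>l=1..k. sin ((real r + 1) * \<theta> l)) * (\<Prod>l=1..k. sin ((real s + 1) * \<theta> l)))"
    using prod_2_cos[of k] unfolding d_def prod.distrib prod_power_distrib[symmetric] \<theta>_def by simp
  have V: "(det V)\<^sup>2 * (\<Prod>l=1..k. sin (\<theta> l))\<^sup>2 = (real (2*k+1) / 4) ^ k"
    unfolding V_def \<theta>_def by (rule det_power_cos_mat[OF assms(1)])
  have inv: "(real (2*k+1) / 4) ^ k * (4 / real (2*k+1)) ^ k = 1"
    by (simp flip: power_mult_distrib)
  have "det ?H * (\<Prod>l=1..k. sin (\<theta> l))\<^sup>2 = (real (2*k+1) / 4) ^ k * (\<Prod>l=1..k. d l)"
    unfolding H V[symmetric] by (simp only: mult_ac)
  also have "\<dots> = (\<Prod>l=1..k. sin ((real r + 1) * \<theta> l)) * (\<Prod>l=1..k. sin ((real s + 1) * \<theta> l))"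
    unfolding d mult.assoc[symmetric] inv by simp
  finally show ?thesis .
qed

section \<open>Return to the integers and evaluation of the sign\<close>

theorem theorem56:
  fixes n k r s :: nat
  assumes "k \<ge> 1" and "r \<le> 2*k - 1" and "s \<le> 2*k - 1"
  shows "det (mat k k (\<lambda>(i,j). int (C_paths (2*k - 1) (2*n + 2*i + 2*j + r + s) r s))) =
    (if gcd (r+1) (2*k+1) \<noteq> 1 \<or> gcd (s+1) (2*k+1) \<noteq> 1 then 0
     else (-1) ^ (\<Sum>i=1..k. (i*(r+1)) div (2*k+1) + (i*(s+1)) div (2*k+1)))"
    (is "det ?H = ?rhs")
proof -
  \<comment> \<open>Each \<open>Q a\<close> will be \<open>0\<close> or \<open>P\<close> up to sign,
    so cancelling \<open>P\<^sup>2\<close> leaves only the sign.\<close>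
  define P where "P = (\<Prod>l=1..k. sin (real l * pi / real (2*k+1)))"
  define Q where "Q a = (\<Prod>l=1..k. sin (real (l*a) * pi / real (2*k+1)))" for a
  have "real_of_int (det ?H) = det (map_mat real_of_int ?H)"
    by (simp add: of_int_hom.hom_det)
  also have "det (map_mat real_of_int ?H) =
      det (mat k k (\<lambda>(i,j). real (C_paths (2*k-1) (2*n + 2*i + 2*j + r + s) r s)))"
    by (rule arg_cong[of _ _ det], rule eq_matI) auto
  finally have det_H: "real_of_int (det ?H) =
      det (mat k k (\<lambda>(i,j). real (C_paths (2*k-1) (2*n + 2*i + 2*j + r + s) r s)))" .
  have "real_of_int (det ?H) * P\<^sup>2 = Q (r+1) * Q (s+1)"
  proof -
    have arg: "(real a + 1) * (real l * pi / real (2*k+1)) = real (l*(a+1)) * pi / real (2*k+1)" for a l :: nat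
      by (simp add: algebra_simps)
    have "r < 2*k" "s < 2*k" using assms by linarith+
    from det_real_C_paths[OF assms(1) this, of n] show ?thesis
      unfolding det_H P_def Q_def arg .
  qed
  moreover have "Q a = (if gcd a (2*k+1) \<noteq> 1 then 0 else (-1) ^ (\<Sum>l=1..k. (l*a) div (2*k+1)) * P)" for a
    using prod_sin_coprime[of a k] prod_sin_not_coprime[of a k]
    unfolding Q_def P_def coprime_iff_gcd_eq_1 by auto
  ultimately have "real_of_int (det ?H) * P\<^sup>2 = real_of_int ?rhs * P\<^sup>2"
    by (simp add: sum.distrib power_add power2_eq_square mult_ac)
  moreover have "P \<noteq> 0" unfolding P_def by (rule prod_sin_pi_fraction_nonzero)
  ultimately have "real_of_int (det ?H) = real_of_int ?rhs"
    using mult_right_cancel[OF power_not_zero[of P 2]] by blast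
  then show ?thesis by (simp only: of_int_eq_iff)
qed

end
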